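(* Let $\|\cdot\|$ be a matrix norm on $\mathbb{R}^{3\times3}$. There is a constant $C$ (independent of $\mathbf A$ and of the unit roundoff $\epsilon$) such that for every $\mathbf A\in\mathbb{R}^{3\times3}$ the value $\mathrm{fl}(I_1)$ of $I_1(\mathbf A)=\mathrm{tr}(\mathbf A)$ computed in floating-point arithmetic as the sum $A_{00}+A_{11}+A_{22}$ satisfies $$|\mathrm{fl}(I_1)-I_1(\mathbf A)|\le C\,\|\mathbf A\|\,\epsilon+\mathcal O(\epsilon^2).$$
   Context: $A_{ij}$, $i,j\in\{0,1,2\}$, are the entries of $\mathbf A$. Floating-point model: each elementary operation $\mathrm{op}\in\{+,-,*,/\}$ is computed with $\mathrm{fl}(x\,\mathrm{op}\,y)=(x\,\mathrm{op}\,y)(1+\delta)$, where $|\delta|\le\epsilon$ and $\delta$ may differ from operation to operation; $\epsilon$ is the unit roundoff. The entries of the input matrix are taken as exact. The sum is evaluated left to right: first $A_{00}+A_{11}$, then $A_{22}$ is added. $C$ denotes a moderate absolute constant (it may depend on the choice of norm). $\mathcal O(\epsilon^2)$ is understood as $\epsilon\to0$ for fixed $\mathbf A$: a quantity bounded by $K\epsilon^2$ for all sufficiently small $\epsilon$, with $K$ independent of $\epsilon$ and of the individual rounding errors (but possibly depending on $\mathbf A$). *)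

theory Defs
  imports "HOL-Analysis.Analysis"
begin

text \<open>
  Matrices are \<^typ>\<open>real^3^3\<close>. The index type \<^typ>\<open>3\<close> is arithmetic modulo 3, so its
  three elements are \<open>0\<close>, \<open>1\<close>, \<open>2\<close>, and \<open>A $ i $ j\<close> is the entry in row \<open>i\<close>, column \<open>j\<close>.
\<close>

text \<open>
  Submultiplicativity is deliberately not required, so this covers both usual meanings of
  ``matrix norm''.
\<close>

definition matrix_norm :: "(real^3^3 \<Rightarrow> real) \<Rightarrow> bool" where
  "matrix_norm N \<longleftrightarrow>
     (\<forall>A. 0 \<le> N A) \<and>
     (\<forall>A. N A = 0 \<longleftrightarrow> A = 0) \<and>
     (\<forall>c A. N (c *\<^sub>R A) = \<bar>c\<bar> * N A) \<and>
     (\<forall>A B. N (A + B) \<le> N A + N B)"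

text \<open>
  All results the floating-point model with unit roundoff \<open>\<epsilon>\<close> admits for one elementary
  operation \<open>f\<close> (one of \<open>+\<close>, \<open>-\<close>, \<open>*\<close>, \<open>/\<close>). The set of outcomes replaces a fixed rounding
  function because each operation has its own error \<open>\<delta>\<close>.
\<close>

definition fl_op :: "real \<Rightarrow> (real \<Rightarrow> real \<Rightarrow> real) \<Rightarrow> real \<Rightarrow> real \<Rightarrow> real set" where
  "fl_op \<epsilon> f x y = {f x y * (1 + \<delta>) | \<delta>. \<bar>\<delta>\<bar> \<le> \<epsilon>}"

definition fl_I1 :: "real \<Rightarrow> real^3^3 \<Rightarrow> real set" where
  "fl_I1 \<epsilon> A = (\<Union>s \<in> fl_op \<epsilon> (+) (A $ 0 $ 0) (A $ 1 $ 1). fl_op \<epsilon> (+) s (A $ 2 $ 2))"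

end

theory Submission
  imports Defs
begin

text \<open>
  The computed value is \<open>((a + b) (1 + \<delta>) + c) (1 + \<delta>')\<close>, so its error is
  \<open>(a + b) \<delta> + (a + b + c) \<delta>' + (a + b) \<delta> \<delta>'\<close>, whose first-order part is at most five times
  the largest diagonal entry. Equivalence of norms in finite dimension bounds the entries by the
  given norm.
\<close>

text \<open>Compactness argument: \<open>N\<close> is continuous for the Euclidean norm, so it
  attains a minimum on the unit sphere. Definiteness makes that minimum positive, and its reciprocal
  serves as \<open>D\<close>.\<close>

lemma norm_le_seminorm_pos_def:
  fixes N :: "'a::euclidean_space \<Rightarrow> real"
  assumes nonneg: "\<And>x. 0 \<le> N x"
    and definite: "\<And>x. N x = 0 \<Longrightarrow> x = 0"
    and scale: "\<And>c x. N (c *\<^sub>R x) = \<bar>c\<bar> * N x"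
    and triangle: "\<And>x y. N (x + y) \<le> N x + N y"
  obtains D where "0 \<le> D" "\<And>x. norm x \<le> D * N x"
proof -
  define M where "M = (\<Sum>b\<in>Basis. N b)"
  have zero: "N 0 = 0" using scale[of 0 0] by simp
  have N_sum: "N (sum f S) \<le> (\<Sum>b\<in>S. N (f b))" if "finite S" for f :: "'a \<Rightarrow> 'a" and S
    using that
  proof (induction S)
    case (insert b S)
    then show ?case using triangle[of "f b" "sum f S"] by simp
  qed (simp add: zero)
  have upper: "N x \<le> M * norm x" for x
  proof -
    have "N x = N (\<Sum>b\<in>Basis. (x \<bullet> b) *\<^sub>R b)" by (simp add: euclidean_representation)
    also have "\<dots> \<le> (\<Sum>b\<in>Basis. \<bar>x \<bullet> b\<bar> * N b)"
      using N_sum[of Basis "\<lambda>b. (x \<bullet> b) *\<^sub>R b"] by (simp add: scale)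
    also have "\<dots> \<le> (\<Sum>b\<in>Basis. norm x * N b)"
      by (intro sum_mono mult_right_mono nonneg Basis_le_norm)
    finally show ?thesis by (simp add: M_def sum_distrib_left mult.commute)
  qed
  \<comment> \<open>The reverse triangle inequality turns the upper bound into a Lipschitz estimate,
    hence continuity.\<close>
  have "N x - N y \<le> M * norm (x - y)" for x y
    using triangle[of "x - y" y] upper[of "x - y"] by simp
  then have "\<bar>N x - N y\<bar> \<le> M * norm (x - y)" for x y
    by (metis abs_le_iff minus_diff_eq norm_minus_commute)
  moreover have "0 \<le> M" by (simp add: M_def nonneg sum_nonneg)
  ultimately have "M-lipschitz_on UNIV N"
    by (intro lipschitz_onI) (auto simp: dist_norm)
  then have "continuous_on (sphere 0 1) N"
    using lipschitz_on_continuous_on continuous_on_subset by blast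
  moreover have "sphere (0::'a) 1 \<noteq> {}" by simp
  ultimately obtain u where u: "u \<in> sphere 0 1" and min: "\<And>x. x \<in> sphere 0 1 \<Longrightarrow> N u \<le> N x"
    using continuous_attains_inf[OF compact_sphere] by metis
  have "N u > 0" using u definite[of u] nonneg[of u] by force
  have "norm x \<le> inverse (N u) * N x" for x
  proof (cases "x = 0")
    case False
    \<comment> \<open>Homogeneity carries the minimum from the unit sphere to every nonzero
      vector.\<close>
    then have "N u \<le> N x / norm x"
      using min[of "inverse (norm x) *\<^sub>R x"] by (simp add: scale field_simps)
    then show ?thesis using False \<open>N u > 0\<close> by (simp add: field_simps)
  qed (simp add: zero)
  then show thesis using that[of "inverse (N u)"] \<open>N u > 0\<close> by simp
qed

text \<open>\<open>sum_3\<close> lists the indices as 1, 2, 3; modulo 3 the last one is 0, so only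
  the order of the summands changes.\<close>

lemma trace_3:
  fixes A :: "real^3^3"
  shows "trace A = A $ 0 $ 0 + A $ 1 $ 1 + A $ 2 $ 2"
proof -
  have "(3::3) = 0" by simp
  then show ?thesis unfolding trace_def sum_3 by (simp only: ac_simps)
qed

lemma fl_sum3_error:
  fixes a b c :: real
  assumes entries: "\<bar>a\<bar> \<le> n" "\<bar>b\<bar> \<le> n" "\<bar>c\<bar> \<le> n"
    and "\<bar>\<delta>\<bar> \<le> \<epsilon>" "\<bar>\<delta>'\<bar> \<le> \<epsilon>"
  shows "\<bar>((a + b) * (1 + \<delta>) + c) * (1 + \<delta>') - (a + b + c)\<bar> \<le> 5 * n * \<epsilon> + 2 * n * \<epsilon>\<^sup>2"
proof -
  \<comment> \<open>One bound per term of the expanded error: two summands meet the first rounding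
    and three the second, whence 5 = 2 + 3; the product of both roundings gives the quadratic
    term.\<close>
  have "\<bar>(a + b) * \<delta>\<bar> \<le> 2 * n * \<epsilon>" "\<bar>(a + b + c) * \<delta>'\<bar> \<le> 3 * n * \<epsilon>"
    "\<bar>(a + b) * (\<delta> * \<delta>')\<bar> \<le> 2 * n * (\<epsilon> * \<epsilon>)"
    unfolding abs_mult by (intro mult_mono; use assms in auto)+
  moreover have "((a + b) * (1 + \<delta>) + c) * (1 + \<delta>') - (a + b + c)
      = (a + b) * \<delta> + (a + b + c) * \<delta>' + (a + b) * (\<delta> * \<delta>')"
    by (simp add: algebra_simps)
  ultimately show ?thesis by (simp add: power2_eq_square abs_le_iff)
qed

theorem mainTheorem5:
  fixes N :: "real^3^3 \<Rightarrow> real"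
  assumes "matrix_norm N"
  shows "\<exists>C::real. \<forall>A::real^3^3. \<exists>K::real. \<forall>\<^sub>F \<epsilon> in at_right 0.
           \<forall>v \<in> fl_I1 \<epsilon> A. \<bar>v - trace A\<bar> \<le> C * N A * \<epsilon> + K * \<epsilon>\<^sup>2"
proof -
  obtain D where D: "\<And>A. norm A \<le> D * N A"
    using norm_le_seminorm_pos_def[of N] assms unfolding matrix_norm_def by metis
  \<comment> \<open>An entry is bounded by the norm of its row, and that by the Euclidean norm of
    the matrix.\<close>
  have entry: "\<bar>A $ i $ j\<bar> \<le> D * N A" for A i j
    using D[of A] Finite_Cartesian_Product.norm_nth_le[of A i]
      Finite_Cartesian_Product.norm_nth_le[of "A $ i" j] by simp
  have "\<bar>v - trace A\<bar> \<le> (5 * D) * N A * \<epsilon> + (2 * (D * N A)) * \<epsilon>\<^sup>2"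
    if computed: "v \<in> fl_I1 \<epsilon> A" for \<epsilon> v A
  proof -
    obtain \<delta> \<delta>' where "\<bar>\<delta>\<bar> \<le> \<epsilon>" "\<bar>\<delta>'\<bar> \<le> \<epsilon>"
      and v: "v = ((A $ 0 $ 0 + A $ 1 $ 1) * (1 + \<delta>) + A $ 2 $ 2) * (1 + \<delta>')"
      using computed by (auto simp: fl_I1_def fl_op_def)
    then show ?thesis
      using fl_sum3_error[OF entry[of A 0 0] entry[of A 1 1] entry[of A 2 2], of \<delta> \<epsilon> \<delta>']
      unfolding v trace_3 by (simp add: mult.assoc)
  qed
  \<comment> \<open>\<open>5 * D\<close> depends on \<open>N\<close> alone, while \<open>K\<close>
    may depend on \<open>A\<close>. The bound holds for every \<epsilon>, so no smallness threshold
    has to be chosen.\<close>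
  then show ?thesis
    by (intro exI[of _ "5 * D"] allI exI[of _ "2 * (D * N A)" for A] always_eventually ballI)
qed

end
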